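(* Let $p$ be a prime and let $Q \in \mathbb{Z}[x]$. Assume that every root of $Q$ in $\mathbb{Z}/p\mathbb{Z}$ satisfies the hypothesis of Hensel's lemma, i.e. for every $b \in \mathbb{Z}$ with $Q(b) \equiv 0 \pmod p$ one has $Q'(b) \not\equiv 0 \pmod p$. Let $$z_p := \left| \{ b \in \{1, 2, \ldots, p\} : Q(b) \equiv 0 \pmod p \} \right|.$$ Let $n_0 \geq 0$ be an integer exceeding every positive integer zero of $Q$, and define $t_{n_0} = 1$ and $t_n = Q(n)\, t_{n-1}$ for $n > n_0$ (so $t_n \neq 0$ for all $n \ge n_0$). Then $$\nu_p(t_n) \sim \frac{z_p\, n}{p-1} \quad \text{as } n \to \infty,$$ in the sense that $\lim_{n\to\infty} \frac{(p-1)\,\nu_p(t_n)}{n} = z_p$.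
   Context: For a nonzero rational $x$, the $p$-adic valuation $\nu_p(x)$ is the integer such that $x = p^{\nu_p(x)} a/b$ with $a,b \in \mathbb{Z}$ not divisible by $p$. $Q'$ denotes the formal derivative of $Q$. *)

theory Defs
  imports Complex_Main "HOL-Computational_Algebra.Computational_Algebra" "HOL-Number_Theory.Cong"
begin

text \<open>
  Meaningful for prime \<open>p\<close> and \<open>x \<noteq> 0\<close> only: for \<open>x = 0\<close> no such \<open>k\<close> exists.
\<close>
definition padic_val :: "nat \<Rightarrow> rat \<Rightarrow> int" where
  "padic_val p x = (THE k. \<exists>a b :: int. \<not> int p dvd a \<and> \<not> int p dvd b \<and>
     x = of_nat p powi k * (of_int a / of_int b))"

lemma padic_val_unique_aux:
  fixes a b c d k l :: int
  assumes p: "prime p" and nd: "\<not> int p dvd a" "\<not> int p dvd b" "\<not> int p dvd c" "\<not> int p dvd d"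
    and eq: "(of_nat p :: rat) powi k * (of_int a / of_int b)
           = of_nat p powi l * (of_int c / of_int d)"
  shows "\<not> k < l"
proof
  assume "k < l"
  define m where "m = nat (l - k)"
  have m: "m > 0" "l = k + int m" using \<open>k < l\<close> by (auto simp: m_def)
  have p0: "(of_nat p :: rat) \<noteq> 0" using p by (auto dest: prime_gt_0_nat)
  have b0: "(of_int b :: rat) \<noteq> 0" "(of_int d :: rat) \<noteq> 0" using nd by auto
  have "(of_nat p :: rat) powi l = of_nat p powi k * of_nat p ^ m"
    using p0 m by (simp add: power_int_add)
  with eq have "(of_nat p :: rat) powi k * (of_int a / of_int b)
      = of_nat p powi k * (of_nat p ^ m * (of_int c / of_int d))"
    by (simp only: mult.assoc)
  moreover have "(of_nat p :: rat) powi k \<noteq> 0" using p0 by simp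
  ultimately have "(of_int a / of_int b :: rat) = of_nat p ^ m * (of_int c / of_int d)"
    using mult_left_cancel by blast
  hence "(of_int (a * d) :: rat) = of_int (int p ^ m * c * b)"
    using b0 by (simp add: field_simps)
  hence "a * d = int p ^ m * c * b" by (simp only: of_int_eq_iff)
  hence "int p dvd a * d" using m by simp
  thus False using p nd by (auto simp: prime_dvd_mult_iff)
qed

lemma padic_val_eqI:
  assumes "prime p" "\<not> int p dvd a" "\<not> int p dvd b"
    and "x = of_nat p powi k * (of_int a / of_int b)"
  shows "padic_val p x = k"
  unfolding padic_val_def
proof (rule the_equality)
  show "\<exists>a b. \<not> int p dvd a \<and> \<not> int p dvd b \<and> x = of_nat p powi k * (of_int a / of_int b)"
    using assms by blast
next
  fix l assume "\<exists>a b. \<not> int p dvd a \<and> \<not> int p dvd b \<and> x = of_nat p powi l * (of_int a / of_int b)"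
  then obtain c d where "\<not> int p dvd c" "\<not> int p dvd d" "x = of_nat p powi l * (of_int c / of_int d)"
    by blast
  with assms padic_val_unique_aux[of p a b c d k l] padic_val_unique_aux[of p c d a b l k]
  show "l = k" by force
qed

lemma padic_val_of_int:
  assumes p: "prime p" and x: "x \<noteq> 0"
  shows "padic_val p (of_int x) = int (multiplicity (int p) x)"
proof -
  have "\<not> is_unit (int p)" using p by (metis not_prime_unit prime_nat_int_transfer)
  with x obtain y where y: "x = int p ^ multiplicity (int p) x * y" "\<not> int p dvd y"
    using multiplicity_decompose' by blast
  have "(of_int x :: rat) = of_int (int p ^ multiplicity (int p) x * y)"
    using y(1) by simp
  hence "(of_int x :: rat)
      = of_nat p powi int (multiplicity (int p) x) * (of_int y / of_int 1)" by simp
  moreover have "\<not> int p dvd 1" using p by (auto dest: prime_gt_1_nat)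
  ultimately show ?thesis using p y(2) padic_val_eqI by blast
qed

end

theory Submission
  imports Defs "HOL-Real_Asymp.Real_Asymp"
begin

text \<open>
  The valuation of \<open>t n\<close> is \<open>\<Sum>k\<ge>1. N k\<close>, where \<open>N k\<close> counts the \<open>m\<close> in \<open>{n0<..n}\<close> with
  \<open>p ^ k dvd Q m\<close>. By Hensel's lemma these \<open>m\<close> form exactly \<open>z\<close> residue classes modulo \<open>p ^ k\<close>, so
  \<open>N k\<close> differs from \<open>z (n - n0) / p ^ k\<close> by at most \<open>z\<close>. As \<open>Q\<close> has polynomial growth, \<open>N k\<close>
  vanishes beyond some \<open>K = O(ln n)\<close>, so the total error is \<open>O(ln n)\<close>, while the geometric series
  contributes the main term \<open>z n / (p - 1)\<close>.
\<close>

section \<open>Expansion and growth of integer polynomials\<close>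

text \<open>Multiplying the expansion of \<open>Q\<close> by \<open>x + y\<close> and collecting
  powers of \<open>y\<close> gives that of \<open>pCons a Q\<close>. The remainder stays in the
  ring, so the identity can be read modulo prime powers.\<close>

lemma poly_taylor1:
  fixes Q :: "'a :: idom poly"
  shows "\<exists>r. poly Q (x + y) = poly Q x + y * poly (pderiv Q) x + y\<^sup>2 * r"
proof (induction Q)
  case 0
  show ?case by auto
next
  case (pCons a Q)
  then obtain r where r: "poly Q (x + y) = poly Q x + y * poly (pderiv Q) x + y\<^sup>2 * r" by blast
  have "poly (pCons a Q) (x + y) = poly (pCons a Q) x + y * poly (pderiv (pCons a Q)) x
      + y\<^sup>2 * (poly (pderiv Q) x + (x + y) * r)"
    by (simp add: r pderiv_pCons power2_eq_square algebra_simps)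
  thus ?case by blast
qed

lemma poly_cong:
  fixes Q :: "int poly"
  assumes "[x = y] (mod m)"
  shows "[poly Q x = poly Q y] (mod m)"
  using assms by (induction Q) (auto intro!: cong_add cong_mult)

text \<open>This will bound the exponents \<open>k\<close> for which \<open>p ^ k\<close> can divide
  a value of \<open>Q\<close>. The normalisation \<open>C \<ge> 1\<close> makes \<open>ln C\<close>
  nonnegative later on.\<close>

lemma poly_int_growth:
  fixes Q :: "int poly"
  obtains C d where "C \<ge> 1" "\<And>m. m \<ge> 1 \<Longrightarrow> \<bar>poly Q m\<bar> \<le> C * m ^ d"
proof -
  have "\<exists>C d. C \<ge> 1 \<and> (\<forall>m\<ge>1. \<bar>poly Q m\<bar> \<le> C * m ^ d)"
  proof (induction Q)
    case 0
    show ?case by (rule exI[of _ 1]) auto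
  next
    case (pCons a Q)
    then obtain C d where C: "C \<ge> 1" "\<And>m. m \<ge> 1 \<Longrightarrow> \<bar>poly Q m\<bar> \<le> C * m ^ d" by blast
    have "\<bar>poly (pCons a Q) m\<bar> \<le> (\<bar>a\<bar> + C) * m ^ Suc d" if m: "m \<ge> 1" for m
    proof -
      have "\<bar>poly (pCons a Q) m\<bar> \<le> \<bar>a\<bar> + m * \<bar>poly Q m\<bar>"
        using m abs_triangle_ineq[of a "m * poly Q m"] by (simp add: abs_mult)
      also have "\<dots> \<le> \<bar>a\<bar> * m ^ Suc d + m * (C * m ^ d)"
      proof (rule add_mono)
        have "1 \<le> m ^ Suc d" using m one_le_power by blast
        thus "\<bar>a\<bar> \<le> \<bar>a\<bar> * m ^ Suc d" using mult_left_mono[of 1 "m ^ Suc d" "\<bar>a\<bar>"] by simp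
        show "m * \<bar>poly Q m\<bar> \<le> m * (C * m ^ d)" using m C(2) by (intro mult_left_mono) auto
      qed
      finally show ?thesis by (simp add: algebra_simps)
    qed
    moreover have "\<bar>a\<bar> + C \<ge> 1" using C(1) by simp
    ultimately show ?case by blast
  qed
  thus ?thesis using that by blast
qed

section \<open>Hensel lifting of simple roots\<close>

text \<open>By Taylor, \<open>poly Q y - poly Q x\<close> is \<open>y - x\<close> times a factor
  congruent to \<open>poly (pderiv Q) x\<close> modulo \<open>p\<close>. That factor is coprime to
  \<open>p\<close>, so all of \<open>p ^ k\<close> must divide \<open>y - x\<close>.\<close>

lemma hensel_unique:
  fixes Q :: "int poly"
  assumes p: "prime p" and simple: "\<not> p dvd poly (pderiv Q) x"
    and xy: "[x = y] (mod p)" and dvd: "p ^ k dvd poly Q x" "p ^ k dvd poly Q y"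
  shows "[x = y] (mod p ^ k)"
proof -
  obtain r where "poly Q (x + (y - x)) = poly Q x + (y - x) * poly (pderiv Q) x + (y - x)\<^sup>2 * r"
    using poly_taylor1 by blast
  hence "poly Q y - poly Q x = (y - x) * (poly (pderiv Q) x + (y - x) * r)"
    by (simp add: power2_eq_square algebra_simps)
  hence "p ^ k dvd (y - x) * (poly (pderiv Q) x + (y - x) * r)" using dvd by (metis dvd_diff)
  moreover have "p dvd (y - x) * r" using xy by (metis cong_iff_dvd_diff cong_sym dvd_mult2)
  hence "\<not> p dvd poly (pderiv Q) x + (y - x) * r" using simple dvd_add_left_iff by blast
  hence "coprime (p ^ k) (poly (pderiv Q) x + (y - x) * r)"
    using p prime_imp_coprime by (metis coprime_power_left_iff)
  ultimately have "p ^ k dvd y - x" using coprime_dvd_mult_left_iff by blast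
  thus ?thesis by (metis cong_iff_dvd_diff cong_sym)
qed

lemma hensel_exists:
  fixes Q :: "int poly"
  assumes p: "prime p" and root: "p dvd poly Q b" and simple: "\<not> p dvd poly (pderiv Q) b"
  shows "\<exists>x. [x = b] (mod p) \<and> p ^ k dvd poly Q x"
proof (cases k)
  case 0
  show ?thesis unfolding 0 by (rule exI[of _ b]) simp
next
  case (Suc j)
  \<comment> \<open>Lifting starts at exponent 1, where \<open>b\<close> itself is a root.\<close>
  have "\<exists>x. [x = b] (mod p) \<and> p ^ Suc j dvd poly Q x"
  proof (induction j)
    case 0
    show ?case using root by (auto intro!: exI[of _ b])
  next
    case (Suc j)
    then obtain x where x: "[x = b] (mod p)" "p ^ Suc j dvd poly Q x" by blast
    obtain c where c: "poly Q x = p ^ Suc j * c" using x(2) by blast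
    have "\<not> p dvd poly (pderiv Q) x" using simple poly_cong[OF x(1)] cong_dvd_iff by blast
    hence "coprime (poly (pderiv Q) x) p" using p prime_imp_coprime coprime_commute by blast
    then obtain u where u: "[poly (pderiv Q) x * u = 1] (mod p)" using cong_solve_coprime_int by blast
    \<comment> \<open>Newton correction: \<open>s\<close> solves
      \<open>c + s * poly (pderiv Q) x = 0\<close> modulo \<open>p\<close>, where \<open>u\<close>
      inverts the derivative.\<close>
    define s where "s = - c * u"
    have "[c + s * poly (pderiv Q) x = c - c * 1] (mod p)"
    proof -
      have "c + s * poly (pderiv Q) x = c - c * (poly (pderiv Q) x * u)"
        by (simp add: s_def algebra_simps)
      thus ?thesis using u by (metis cong_diff cong_refl cong_scalar_left)
    qed
    hence dvd: "p dvd c + s * poly (pderiv Q) x" by (simp add: cong_0_iff)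
    obtain r where "poly Q (x + p ^ Suc j * s)
        = poly Q x + p ^ Suc j * s * poly (pderiv Q) x + (p ^ Suc j * s)\<^sup>2 * r"
      using poly_taylor1 by blast
    \<comment> \<open>The square of \<open>p ^ Suc j\<close> contains one more factor
      \<open>p\<close> than \<open>p ^ Suc j\<close>, so the quadratic term does not disturb the
      gain of one power.\<close>
    hence "poly Q (x + p ^ Suc j * s)
        = p ^ Suc j * (c + s * poly (pderiv Q) x + p * (p ^ j * s\<^sup>2 * r))"
      by (simp add: c power2_eq_square algebra_simps)
    moreover have "p dvd c + s * poly (pderiv Q) x + p * (p ^ j * s\<^sup>2 * r)" using dvd by simp
    ultimately have "p ^ Suc j * p dvd poly Q (x + p ^ Suc j * s)" by (metis dvd_refl mult_dvd_mono)
    moreover have "[x + p ^ Suc j * s = b] (mod p)"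
      using x(1) cong_add[OF x(1), of "p ^ Suc j * s" 0] by (simp add: cong_0_iff)
    ultimately show ?case by (metis power_Suc2)
  qed
  thus ?thesis using Suc by blast
qed

section \<open>Counting roots modulo prime powers in an interval\<close>

text \<open>Writing \<open>m = x + q * j\<close> turns the count into a difference of two floors,
  which is within 1 of the difference of their arguments.\<close>

lemma card_cong_interval:
  fixes a b q x :: int
  assumes q: "q > 0" and ab: "a \<le> b"
  shows "\<bar>real (card {m \<in> {a<..b}. [m = x] (mod q)}) - real_of_int (b - a) / real_of_int q\<bar> \<le> 1"
proof -
  have le_div: "j \<le> u div q \<longleftrightarrow> q * j \<le> u" for j u
  proof
    assume "j \<le> u div q"
    hence "q * j \<le> q * (u div q)" using q by simp
    also have "\<dots> \<le> u" using q pos_mod_sign[of q u] by (simp add: minus_mod_eq_mult_div[symmetric])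
    finally show "q * j \<le> u" .
  next
    assume "q * j \<le> u"
    thus "j \<le> u div q" using zdiv_mono1[of "q * j" u q] q by simp
  qed
  have bounds: "a < x + q * j \<longleftrightarrow> (a - x) div q < j" "x + q * j \<le> b \<longleftrightarrow> j \<le> (b - x) div q" for j
    using le_div[of j "a - x"] le_div[of j "b - x"] by linarith+
  have "{m \<in> {a<..b}. [m = x] (mod q)} = (\<lambda>j. x + q * j) ` {(a - x) div q<..(b - x) div q}"
  proof (intro set_eqI iffI)
    fix m assume m: "m \<in> {m \<in> {a<..b}. [m = x] (mod q)}"
    then obtain j where "m = x + q * j" by (metis (mono_tags, lifting) cong_iff_lin cong_sym mem_Collect_eq)
    thus "m \<in> (\<lambda>j. x + q * j) ` {(a - x) div q<..(b - x) div q}" using m bounds by auto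
  next
    fix m assume "m \<in> (\<lambda>j. x + q * j) ` {(a - x) div q<..(b - x) div q}"
    thus "m \<in> {m \<in> {a<..b}. [m = x] (mod q)}" using bounds by (auto simp: cong_iff_dvd_diff)
  qed
  moreover have "inj_on (\<lambda>j. x + q * j) {(a - x) div q<..(b - x) div q}"
    using q by (auto intro: inj_onI)
  ultimately have "card {m \<in> {a<..b}. [m = x] (mod q)} = nat ((b - x) div q - (a - x) div q)"
    by (simp add: card_image)
  moreover have "(a - x) div q \<le> (b - x) div q" using q ab by (simp add: zdiv_mono1)
  ultimately have card: "real (card {m \<in> {a<..b}. [m = x] (mod q)})
      = of_int \<lfloor>real_of_int (b - x) / real_of_int q\<rfloor> - of_int \<lfloor>real_of_int (a - x) / real_of_int q\<rfloor>"
    unfolding floor_divide_of_int_eq by simp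
  have "real_of_int (b - a) / real_of_int q
      = real_of_int (b - x) / real_of_int q - real_of_int (a - x) / real_of_int q"
    by (simp add: diff_divide_distrib)
  thus ?thesis unfolding card by linarith
qed

text \<open>Each root modulo \<open>p\<close> lifts to one class modulo \<open>p ^ k\<close>, and
  these classes exhaust the roots. Each of the \<open>z\<close> classes contributes an error of at
  most 1.\<close>

lemma card_roots_interval:
  fixes Q :: "int poly" and p a b :: int
  assumes p: "prime p" and simple: "\<And>x. p dvd poly Q x \<Longrightarrow> \<not> p dvd poly (pderiv Q) x"
    and k: "k > 0" and ab: "a \<le> b"
  defines "z \<equiv> real (card {x \<in> {1..p}. p dvd poly Q x})"
  shows "\<bar>real (card {m \<in> {a<..b}. p ^ k dvd poly Q m}) - z * real_of_int (b - a) / real_of_int (p ^ k)\<bar> \<le> z"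
proof -
  define R where "R = {x \<in> {1..p}. p dvd poly Q x}"
  have z: "z = real (card R)" unfolding z_def R_def ..
  have finR: "finite R" unfolding R_def by (rule finite_subset[of _ "{1..p}"]) auto
  have p0: "p > 0" using p by (simp add: prime_gt_0_int)
  have "\<forall>c\<in>R. \<exists>x. [x = c] (mod p) \<and> p ^ k dvd poly Q x"
    using hensel_exists[OF p] simple by (auto simp: R_def)
  then obtain x where x: "\<And>c. c \<in> R \<Longrightarrow> [x c = c] (mod p)" "\<And>c. c \<in> R \<Longrightarrow> p ^ k dvd poly Q (x c)"
    by metis
  define A where "A c = {m \<in> {a<..b}. [m = x c] (mod p ^ k)}" for c
  have cong_p: "[u = v] (mod p)" if "[u = v] (mod p ^ k)" for u v
    using that k cong_dvd_modulus dvd_power by blast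
  have "{m \<in> {a<..b}. p ^ k dvd poly Q m} = (\<Union>c\<in>R. A c)"
  proof (intro set_eqI iffI)
    fix m assume m: "m \<in> {m \<in> {a<..b}. p ^ k dvd poly Q m}"
    have pm: "p dvd poly Q m" using m k dvd_trans dvd_power by blast
    \<comment> \<open>The shift by one picks the representative of \<open>m\<close> in
      \<open>{1..p}\<close> instead of \<open>{0..p-1}\<close>.\<close>
    define c where "c = (m - 1) mod p + 1"
    have c: "c \<in> {1..p}" using p0 by (simp add: c_def add1_zle_eq)
    have "m - c = m - 1 - (m - 1) mod p" by (simp add: c_def)
    hence mc: "[m = c] (mod p)" by (metis cong_iff_dvd_diff dvd_minus_mod)
    have cR: "c \<in> R" using c pm cong_dvd_iff[OF poly_cong[OF mc]] by (simp add: R_def)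
    have "[m = x c] (mod p)" using mc x(1)[OF cR] cong_sym cong_trans by blast
    hence "[m = x c] (mod p ^ k)" using hensel_unique[OF p] simple pm x(2)[OF cR] m by blast
    thus "m \<in> (\<Union>c\<in>R. A c)" using cR m by (auto simp: A_def)
  next
    fix m assume "m \<in> (\<Union>c\<in>R. A c)"
    then obtain c where "c \<in> R" "m \<in> {a<..b}" "[m = x c] (mod p ^ k)" by (auto simp: A_def)
    thus "m \<in> {m \<in> {a<..b}. p ^ k dvd poly Q m}" using x(2) poly_cong cong_dvd_iff by blast
  qed
  moreover have "card (\<Union>c\<in>R. A c) = (\<Sum>c\<in>R. card (A c))"
  proof (rule card_UN_disjoint[OF finR])
    show "\<forall>c\<in>R. finite (A c)"
      unfolding A_def by (auto intro: finite_subset[of _ "{a<..b}"])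
    \<comment> \<open>A common element would make \<open>c\<close> and \<open>d\<close> congruent
      modulo \<open>p\<close>, but distinct elements of \<open>{1..p}\<close> differ by less than
      \<open>p\<close>.\<close>
    show "\<forall>c\<in>R. \<forall>d\<in>R. c \<noteq> d \<longrightarrow> A c \<inter> A d = {}"
    proof (intro ballI impI, rule ccontr)
      fix c d assume cd: "c \<in> R" "d \<in> R" "c \<noteq> d" "A c \<inter> A d \<noteq> {}"
      then obtain m where "[m = x c] (mod p)" "[m = x d] (mod p)" using cong_p by (auto simp: A_def)
      hence "[c = d] (mod p)" using x(1)[OF cd(1)] x(1)[OF cd(2)]
        by (meson cong_sym cong_trans)
      hence "p dvd c - d" by (simp add: cong_iff_dvd_diff)
      moreover have "\<bar>c - d\<bar> < \<bar>p\<bar>" using cd by (auto simp: R_def)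
      ultimately show False using dvd_imp_le_int[of "c - d" p] cd(3) by linarith
    qed
  qed
  ultimately have "real (card {m \<in> {a<..b}. p ^ k dvd poly Q m}) - z * real_of_int (b - a) / real_of_int (p ^ k)
      = (\<Sum>c\<in>R. real (card (A c)) - real_of_int (b - a) / real_of_int (p ^ k))"
    by (simp add: z sum_subtractf)
  also have "\<bar>\<dots>\<bar> \<le> (\<Sum>c\<in>R. 1)"
    unfolding A_def by (rule order.trans[OF sum_abs sum_mono], rule card_cong_interval) (use p0 ab in auto)
  finally show ?thesis unfolding z by simp
qed

section \<open>Estimating the summed multiplicities\<close>

text \<open>Double counting of the pairs \<open>(m, k)\<close> with \<open>p ^ k dvd f m\<close>:
  for fixed \<open>m\<close> the admissible \<open>k\<close> are exactly 1 up to the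
  multiplicity.\<close>

lemma sum_multiplicity_eq_sum_card:
  fixes f :: "'b \<Rightarrow> 'a :: factorial_semiring"
  assumes fin: "finite S" and p: "prime p" and bound: "\<And>m. m \<in> S \<Longrightarrow> f m \<noteq> 0 \<and> multiplicity p (f m) \<le> K"
  shows "(\<Sum>m\<in>S. multiplicity p (f m)) = (\<Sum>k=1..K. card {m \<in> S. p ^ k dvd f m})"
proof -
  have "(\<Sum>m\<in>S. multiplicity p (f m)) = (\<Sum>m\<in>S. card {k \<in> {1..K}. p ^ k dvd f m})"
  proof (rule sum.cong[OF refl])
    fix m assume m: "m \<in> S"
    have "{k \<in> {1..K}. p ^ k dvd f m} = {1..multiplicity p (f m)}"
      using bound[OF m] p by (auto simp: power_dvd_iff_le_multiplicity)
    thus "multiplicity p (f m) = card {k \<in> {1..K}. p ^ k dvd f m}" by simp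
  qed
  also have "\<dots> = (\<Sum>k=1..K. card {m \<in> S. p ^ k dvd f m})"
    using fin sum.swap_restrict[of S "{1..K}" "\<lambda>_ _. 1::nat" "\<lambda>m k. p ^ k dvd f m"] by simp
  finally show ?thesis .
qed

lemma sum_inverse_powers:
  fixes q :: real
  assumes "q \<noteq> 0"
  shows "(q - 1) * (\<Sum>k=1..K. 1 / q ^ k) = 1 - 1 / q ^ K"
  using assms by (induction K) (auto simp: field_simps)

text \<open>Each of the \<open>K\<close> exponents costs an error of at most \<open>z\<close>. The
  factor \<open>p - 1\<close> clears the denominator of the truncated geometric series.\<close>

lemma sum_multiplicity_poly_estimate:
  fixes Q :: "int poly" and p a b :: int
  assumes p: "prime p" and simple: "\<And>x. p dvd poly Q x \<Longrightarrow> \<not> p dvd poly (pderiv Q) x"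
    and ab: "a \<le> b"
    and bound: "\<And>m. m \<in> {a<..b} \<Longrightarrow> poly Q m \<noteq> 0 \<and> multiplicity p (poly Q m) \<le> K"
  defines "z \<equiv> real (card {x \<in> {1..p}. p dvd poly Q x})"
  shows "\<bar>(real_of_int p - 1) * real (\<Sum>m\<in>{a<..b}. multiplicity p (poly Q m))
      - z * real_of_int (b - a) * (1 - 1 / real_of_int p ^ K)\<bar> \<le> (real_of_int p - 1) * (z * real K)"
proof -
  have p1: "real_of_int p > 1" using p by (simp add: prime_gt_1_int)
  let ?N = "\<lambda>k. real (card {m \<in> {a<..b}. p ^ k dvd poly Q m})"
  have "real (\<Sum>m\<in>{a<..b}. multiplicity p (poly Q m)) = (\<Sum>k=1..K. ?N k)"
    by (subst sum_multiplicity_eq_sum_card[where K = K]) (use p bound in auto)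
  moreover have "\<bar>(\<Sum>k=1..K. ?N k - z * real_of_int (b - a) / real_of_int (p ^ k))\<bar> \<le> (\<Sum>k=1..K. z)"
    unfolding z_def by (rule order.trans[OF sum_abs sum_mono], rule card_roots_interval)
      (use p simple ab in auto)
  moreover have "(\<Sum>k=1..K. z * real_of_int (b - a) / real_of_int (p ^ k))
      = z * real_of_int (b - a) * (\<Sum>k=1..K. 1 / real_of_int p ^ k)"
    by (simp add: sum_distrib_left)
  ultimately have "\<bar>real (\<Sum>m\<in>{a<..b}. multiplicity p (poly Q m))
      - z * real_of_int (b - a) * (\<Sum>k=1..K. 1 / real_of_int p ^ k)\<bar> \<le> z * real K"
    by (simp only: sum_subtractf) (simp add: mult.commute)
  hence "(real_of_int p - 1) * \<bar>real (\<Sum>m\<in>{a<..b}. multiplicity p (poly Q m))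
      - z * real_of_int (b - a) * (\<Sum>k=1..K. 1 / real_of_int p ^ k)\<bar> \<le> (real_of_int p - 1) * (z * real K)"
    using p1 by (intro mult_left_mono) auto
  moreover have "(real_of_int p - 1) * \<bar>y\<bar> = \<bar>(real_of_int p - 1) * y\<bar>" for y
    using p1 by (simp add: abs_mult)
  moreover have "(real_of_int p - 1) * (v - z * w * s) = (real_of_int p - 1) * v - z * w * ((real_of_int p - 1) * s)"
    for v w s by (simp add: algebra_simps)
  ultimately show ?thesis using sum_inverse_powers[of "real_of_int p" K] p1 by simp
qed

text \<open>Since \<open>p \<ge> 2\<close>, 2 to the multiplicity is at most
  \<open>\<bar>x\<bar>\<close>; base 2 suffices because only logarithmic order matters.\<close>

lemma multiplicity_le_log:
  fixes p x :: int
  assumes p: "prime p" and x: "x \<noteq> 0"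
  shows "real (multiplicity p x) * ln 2 \<le> ln \<bar>real_of_int x\<bar>"
proof -
  have "(2::int) ^ multiplicity p x \<le> p ^ multiplicity p x"
    using p by (intro power_mono) (auto simp: prime_ge_2_int)
  also have "\<dots> \<le> \<bar>x\<bar>" using dvd_imp_le_int[OF x multiplicity_dvd, of p] p prime_gt_0_int by force
  finally have "real_of_int (2 ^ multiplicity p x) \<le> real_of_int \<bar>x\<bar>" using of_int_le_iff by blast
  hence "2 ^ multiplicity p x \<le> \<bar>real_of_int x\<bar>" by simp
  hence "ln (2 ^ multiplicity p x) \<le> ln \<bar>real_of_int x\<bar>" using x by (subst ln_le_cancel_iff) auto
  thus ?thesis by (simp add: ln_realpow)
qed

section \<open>Passage to the limit\<close>

theorem theorem1p2:
  fixes p n0 :: nat and Q :: "int poly" and t :: "nat \<Rightarrow> int"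
  assumes "prime p"
    and "\<And>b :: int. [poly Q b = 0] (mod int p) \<Longrightarrow> \<not> [poly (pderiv Q) b = 0] (mod int p)"
    and "\<And>m :: int. m > 0 \<Longrightarrow> poly Q m = 0 \<Longrightarrow> m < int n0"
    and "t n0 = 1"
    and "\<And>n. n > n0 \<Longrightarrow> t n = poly Q (int n) * t (n - 1)"
  shows "(\<forall>n\<ge>n0. t n \<noteq> 0) \<and>
    (\<lambda>n. (real p - 1) * real_of_int (padic_val p (of_int (t n))) / real n)
      \<longlonglongrightarrow> real (card {b \<in> {1..int p}. [poly Q b = 0] (mod int p)})"
proof -
  have p: "prime (int p)" using assms(1) by simp
  have p1: "real p > 1" using prime_gt_1_nat[OF assms(1)] by simp
  have simple: "\<not> int p dvd poly (pderiv Q) b" if "int p dvd poly Q b" for b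
    using assms(2)[of b] that by (simp add: cong_0_iff)
  have Q0: "poly Q m \<noteq> 0" if "m > int n0" for m using assms(3)[of m] that by force
  \<comment> \<open>Nonvanishing is carried through the induction because multiplicities add only
    over nonzero factors.\<close>
  have t: "t n \<noteq> 0 \<and> multiplicity (int p) (t n) = (\<Sum>m\<in>{int n0<..int n}. multiplicity (int p) (poly Q m))"
    if "n \<ge> n0" for n
    using that
  proof (induction n rule: dec_induct)
    case base
    show ?case using assms(4) by simp
  next
    case (step n)
    have "{int n0<..int (Suc n)} = insert (int (Suc n)) {int n0<..int n}" using step by auto
    moreover have "t (Suc n) = poly Q (int (Suc n)) * t n" using assms(5)[of "Suc n"] step by simp
    moreover have "poly Q (int (Suc n)) \<noteq> 0" using Q0 step by simp
    ultimately show ?case using step p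
      by (simp add: prime_elem_multiplicity_mult_distrib)
  qed
  define z where "z = real (card {b \<in> {1..int p}. [poly Q b = 0] (mod int p)})"
  have z: "z = real (card {b \<in> {1..int p}. int p dvd poly Q b})" by (simp add: z_def cong_0_iff)
  obtain C d where C: "C \<ge> 1" "\<And>m. m \<ge> 1 \<Longrightarrow> \<bar>poly Q m\<bar> \<le> C * m ^ d" using poly_int_growth by blast
  \<comment> \<open>The exponent \<open>d + 1\<close> instead of \<open>d\<close> makes \<open>K\<close> tend to infinity even for constant \<open>Q\<close>.\<close>
  define c e :: real where "c = ln (real_of_int C)" and "e = real d + 1"
  define K where "K n = nat \<lceil>(c + e * ln (real n)) / ln 2\<rceil>" for n
  have e: "e > 0" and c: "c \<ge> 0" using C(1) by (simp_all add: e_def c_def)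
  \<comment> \<open>One cutoff serves all \<open>m\<close> up to \<open>n\<close>: take logarithms
    in \<open>\<bar>poly Q m\<bar> \<le> C * int n ^ d\<close>.\<close>
  have bound: "multiplicity (int p) (poly Q m) \<le> K n" if m: "m \<in> {int n0<..int n}" for m n
  proof -
    have m1: "m \<ge> 1" "m \<le> int n" "poly Q m \<noteq> 0" using m Q0 by auto
    have "\<bar>poly Q m\<bar> \<le> C * m ^ d" using C m1 by blast
    also have "\<dots> \<le> C * int n ^ d" using C m1 by (intro mult_left_mono power_mono) auto
    finally have "real_of_int \<bar>poly Q m\<bar> \<le> real_of_int (C * int n ^ d)" using of_int_le_iff by blast
    hence "\<bar>real_of_int (poly Q m)\<bar> \<le> real_of_int C * real n ^ d" by simp
    hence "ln \<bar>real_of_int (poly Q m)\<bar> \<le> ln (real_of_int C * real n ^ d)"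
      using m1 C by (subst ln_le_cancel_iff) auto
    also have "\<dots> = c + real d * ln (real n)"
      using m1 C by (subst ln_mult) (auto simp: ln_realpow c_def)
    also have "\<dots> \<le> c + e * ln (real n)" using m1 by (simp add: e_def algebra_simps)
    finally have "real (multiplicity (int p) (poly Q m)) * ln 2 \<le> c + e * ln (real n)"
      using multiplicity_le_log[OF p m1(3)] by linarith
    hence "real (multiplicity (int p) (poly Q m)) \<le> (c + e * ln (real n)) / ln 2"
      by (simp add: pos_le_divide_eq)
    thus ?thesis unfolding K_def by linarith
  qed
  define V where "V n = (real p - 1) * real_of_int (padic_val p (of_int (t n)))" for n
  define M where "M n = z * (real n - real n0) * (1 - 1 / real p ^ K n)" for n
  have est: "\<bar>V n - M n\<bar> \<le> (real p - 1) * (z * real (K n))" if "n \<ge> n0" for n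
    using sum_multiplicity_poly_estimate[OF p simple, of "int n0" "int n" "K n"] bound Q0 that t[OF that]
      padic_val_of_int[OF assms(1), of "t n"]
    by (simp add: V_def M_def z)
  \<comment> \<open>The cutoff must grow so that the truncation factor in \<open>M\<close> tends to
    1, yet be \<open>o(n)\<close> so that the error in \<open>est\<close> disappears after division
    by \<open>n\<close>.\<close>
  have K_inf: "filterlim K at_top sequentially"
    unfolding K_def using e by real_asymp
  have K_small: "(\<lambda>n. real (K n) / real n) \<longlonglongrightarrow> 0"
  proof (rule tendsto_sandwich[OF _ _ tendsto_const])
    show "(\<lambda>n. ((c + e * ln (real n)) / ln 2 + 1) / real n) \<longlonglongrightarrow> 0" by real_asymp
    show "\<forall>\<^sub>F n in sequentially. real (K n) / real n \<le> ((c + e * ln (real n)) / ln 2 + 1) / real n"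
      using eventually_gt_at_top[of 0]
    proof eventually_elim
      case (elim n)
      \<comment> \<open>Nonnegativity matters because \<open>nat\<close> sends negative ceilings to
        0, which could break the upper bound.\<close>
      have "(c + e * ln (real n)) / ln 2 \<ge> 0" using c e elim by simp
      hence "real (K n) \<le> (c + e * ln (real n)) / ln 2 + 1" unfolding K_def by linarith
      thus ?case by (rule divide_right_mono) simp
    qed
  qed simp
  have "(\<lambda>n. z * ((real n - real n0) / real n) * (1 - (1 / real p) ^ K n)) \<longlonglongrightarrow> z * 1 * (1 - 0)"
  proof (intro tendsto_intros)
    show "(\<lambda>n. (real n - real n0) / real n) \<longlonglongrightarrow> 1" by real_asymp
    show "(\<lambda>n. (1 / real p) ^ K n) \<longlonglongrightarrow> 0"
      by (rule filterlim_compose[OF LIMSEQ_power_zero K_inf]) (use p1 in simp)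
  qed
  hence main: "(\<lambda>n. M n / real n) \<longlonglongrightarrow> z" by (simp add: M_def power_one_over)
  have "(\<lambda>n. (V n - M n) / real n) \<longlonglongrightarrow> 0"
  proof (rule tendsto_0_le[OF K_small])
    show "\<forall>\<^sub>F n in sequentially.
        norm ((V n - M n) / real n) \<le> norm (real (K n) / real n) * ((real p - 1) * z)"
      using eventually_ge_at_top[of n0]
    proof eventually_elim
      case (elim n)
      thus ?case using divide_right_mono[OF est[OF elim], of "real n"] by (simp add: mult_ac)
    qed
  qed
  hence "(\<lambda>n. V n / real n) \<longlonglongrightarrow> z"
    using tendsto_add[OF main, of "\<lambda>n. (V n - M n) / real n" 0] by (simp add: diff_divide_distrib)
  thus ?thesis using t by (simp add: V_def z_def)
qed

end
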